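(* Let $G$ be a finite group, $K\le G$ a subgroup, $(\theta,V)$ an irreducible $K$-representation, and let $T\mapsto T^\sharp$ be a fixed antiautomorphism of the algebra $\mathrm{End}(V)$. Suppose that there exists an antiautomorphism $\tau:G\to G$ such that: - $\tau(K)=K$; - $\theta(\tau(k))=\theta(k)^\sharp$ for all $k\in K$; - for every $s\in\mathcal S_0$ there exist $k_1,k_2\in K$ such that $\tau(s)=k_1sk_2$ and $\theta(k_2)^*T\theta(k_1)^*=T^\sharp$ for all $T\in\mathrm{Hom}_{K_s}(\mathrm{Res}^K_{K_s}\theta,\theta^s)$; - $(T^\sharp)^*=(T^* )^\sharp$ for all $T\in\mathrm{End}(V)$. Then the triple $(G,K,\theta)$ is multiplicity-free.
   Context: Representations are unitary on finite-dimensional complex inner product spaces; $T^*$ is the adjoint of $T$. $(G,K,\theta)$ is called a multiplicity-free triple if $\mathrm{Ind}_K^G\theta$ decomposes without multiplicities (every irreducible $G$-representation occurs at most once). An antiautomorphism of $\mathrm{End}(V)$ is a bijective linear map with $(ST)^\sharp=T^\sharp S^\sharp$; an antiautomorphism of $G$ is a bijection with $\tau(g_1g_2)=\tau(g_2)\tau(g_1)$. $\mathcal S\ni 1_G$ is a complete set of representatives of the double cosets $KsK$ in $G$; for $s\in\mathcal S$, $K_s=K\cap sKs^{-1}$, and $\theta^s$ is the $K_s$-representation on $V$ given by $\theta^s(x)=\theta(s^{-1}xs)$. $\mathcal S_0=\{s\in\mathcal S:\mathrm{Hom}_{K_s}(\mathrm{Res}^K_{K_s}\theta,\theta^s)\ne0\}$.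 *)

theory Defs
  imports Complex_Main "HOL-Library.FuncSet" "HOL-Library.Function_Algebras" "HOL-Algebra.Coset"
begin

text \<open>Inner products are linear in the first argument. The space is a subspace \<open>V\<close> of an ambient
  vector space, so that subrepresentations are again representations; \<open>ip\<close> is constrained on \<open>V\<close>
  only. The condition \<open>0 < Re (ip x x)\<close> suffices because \<open>ip x x\<close> is real by conjugate symmetry.\<close>

locale fin_dim_inner_space = vector_space scale
  for scale :: "complex \<Rightarrow> 'v::ab_group_add \<Rightarrow> 'v" and V :: "'v set"
    and ip :: "'v \<Rightarrow> 'v \<Rightarrow> complex" +
  assumes subspace_V: "subspace V"
    and fin_dim: "\<exists>B. finite B \<and> span B = V"
    and ip_add_left: "\<lbrakk>x \<in> V; y \<in> V; z \<in> V\<rbrakk> \<Longrightarrow> ip (x + y) z = ip x z + ip y z"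
    and ip_scale_left: "\<lbrakk>x \<in> V; y \<in> V\<rbrakk> \<Longrightarrow> ip (scale c x) y = c * ip x y"
    and ip_commute: "\<lbrakk>x \<in> V; y \<in> V\<rbrakk> \<Longrightarrow> ip x y = cnj (ip y x)"
    and ip_pos: "\<lbrakk>x \<in> V; x \<noteq> 0\<rbrakk> \<Longrightarrow> 0 < Re (ip x x)"

locale unitary_rep = group G + fin_dim_inner_space scale V ip
  for G (structure) and scale :: "complex \<Rightarrow> 'v::ab_group_add \<Rightarrow> 'v" and V and ip +
  fixes \<rho> :: "'g \<Rightarrow> 'v \<Rightarrow> 'v"
  assumes rep_closed: "\<lbrakk>g \<in> carrier G; v \<in> V\<rbrakk> \<Longrightarrow> \<rho> g v \<in> V"
    and rep_add: "\<lbrakk>g \<in> carrier G; v \<in> V; w \<in> V\<rbrakk> \<Longrightarrow> \<rho> g (v + w) = \<rho> g v + \<rho> g w"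
    and rep_scale: "\<lbrakk>g \<in> carrier G; v \<in> V\<rbrakk> \<Longrightarrow> \<rho> g (scale c v) = scale c (\<rho> g v)"
    and rep_one: "v \<in> V \<Longrightarrow> \<rho> \<one> v = v"
    and rep_mult: "\<lbrakk>g \<in> carrier G; h \<in> carrier G; v \<in> V\<rbrakk> \<Longrightarrow> \<rho> (g \<otimes> h) v = \<rho> g (\<rho> h v)"
    and rep_unitary: "\<lbrakk>g \<in> carrier G; v \<in> V; w \<in> V\<rbrakk> \<Longrightarrow> ip (\<rho> g v) (\<rho> g w) = ip v w"

locale irreducible_rep = unitary_rep +
  assumes nonzero: "V \<noteq> {0}"
    and irreducible: "\<lbrakk>subspace W; W \<subseteq> V; \<forall>g\<in>carrier G. \<rho> g ` W \<subseteq> W\<rbrakk> \<Longrightarrow> W = {0} \<or> W = V"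

text \<open>\<open>Hom\<^sub>H(\<rho>\<^sub>1, \<rho>\<^sub>2)\<close>; extensionality makes each element a genuine map \<open>V\<^sub>1 \<rightarrow> V\<^sub>2\<close>. Restriction of
  a representation to \<open>H\<close> is implicit.\<close>

definition intertwiners ::
  "'g set \<Rightarrow> (complex \<Rightarrow> 'v::ab_group_add \<Rightarrow> 'v) \<Rightarrow> 'v set \<Rightarrow> ('g \<Rightarrow> 'v \<Rightarrow> 'v)
    \<Rightarrow> 'v set \<Rightarrow> ('g \<Rightarrow> 'v \<Rightarrow> 'v) \<Rightarrow> ('v \<Rightarrow> 'v) set" where
  "intertwiners H scale V\<^sub>1 \<rho>\<^sub>1 V\<^sub>2 \<rho>\<^sub>2 =
    {T \<in> V\<^sub>1 \<rightarrow>\<^sub>E V\<^sub>2.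
      (\<forall>v\<in>V\<^sub>1. \<forall>w\<in>V\<^sub>1. T (v + w) = T v + T w) \<and>
      (\<forall>c. \<forall>v\<in>V\<^sub>1. T (scale c v) = scale c (T v)) \<and>
      (\<forall>h\<in>H. \<forall>v\<in>V\<^sub>1. T (\<rho>\<^sub>1 h v) = \<rho>\<^sub>2 h (T v))}"

definition equivalent_reps ::
  "('g, 'm) monoid_scheme \<Rightarrow> (complex \<Rightarrow> 'v::ab_group_add \<Rightarrow> 'v) \<Rightarrow> 'v set \<Rightarrow> ('g \<Rightarrow> 'v \<Rightarrow> 'v)
    \<Rightarrow> 'v set \<Rightarrow> ('g \<Rightarrow> 'v \<Rightarrow> 'v) \<Rightarrow> bool" where
  "equivalent_reps G scale V\<^sub>1 \<rho>\<^sub>1 V\<^sub>2 \<rho>\<^sub>2 \<longleftrightarrow>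
    (\<exists>T \<in> intertwiners (carrier G) scale V\<^sub>1 \<rho>\<^sub>1 V\<^sub>2 \<rho>\<^sub>2. bij_betw T V\<^sub>1 V\<^sub>2)"

text \<open>\<open>\<W>\<close> is the set of summands of an orthogonal decomposition of \<open>V\<close> into irreducible
  subrepresentations (the sum is direct because the summands are nonzero and orthogonal).\<close>

definition irreducible_decomposition ::
  "('g, 'm) monoid_scheme \<Rightarrow> (complex \<Rightarrow> 'v::ab_group_add \<Rightarrow> 'v) \<Rightarrow> 'v set
    \<Rightarrow> ('v \<Rightarrow> 'v \<Rightarrow> complex) \<Rightarrow> ('g \<Rightarrow> 'v \<Rightarrow> 'v) \<Rightarrow> 'v set set \<Rightarrow> bool" where
  "irreducible_decomposition G scale V ip \<rho> \<W> \<longleftrightarrow>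
    finite \<W> \<and>
    (\<forall>W\<in>\<W>. W \<subseteq> V \<and> irreducible_rep G scale W ip \<rho>) \<and>
    (\<forall>W\<in>\<W>. \<forall>W'\<in>\<W>. W \<noteq> W' \<longrightarrow> (\<forall>v\<in>W. \<forall>w\<in>W'. ip v w = 0)) \<and>
    module.span scale (\<Union>\<W>) = V"

definition multiplicity_free ::
  "('g, 'm) monoid_scheme \<Rightarrow> (complex \<Rightarrow> 'v::ab_group_add \<Rightarrow> 'v) \<Rightarrow> 'v set
    \<Rightarrow> ('v \<Rightarrow> 'v \<Rightarrow> complex) \<Rightarrow> ('g \<Rightarrow> 'v \<Rightarrow> 'v) \<Rightarrow> bool" where
  "multiplicity_free G scale V ip \<rho> \<longleftrightarrow>
    (\<exists>\<W>. irreducible_decomposition G scale V ip \<rho> \<W> \<and>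
      (\<forall>W\<in>\<W>. \<forall>W'\<in>\<W>. W \<noteq> W' \<longrightarrow> \<not> equivalent_reps G scale W \<rho> W' \<rho>))"

text \<open>The induced representation acts by left translation on the functions \<open>f : G \<rightarrow> V\<close> with
  \<open>f(gk) = \<theta>(k\<inverse>) f(g)\<close>. Such functions are extended by \<open>0\<close> outside the carrier of \<open>G\<close>, so that they
  form a subspace of the full function type with pointwise operations. Here \<open>V\<close> is a whole type.\<close>

definition fun_scale ::
  "(complex \<Rightarrow> 'v \<Rightarrow> 'v) \<Rightarrow> complex \<Rightarrow> ('g \<Rightarrow> 'v) \<Rightarrow> 'g \<Rightarrow> 'v" where
  "fun_scale scale c f = (\<lambda>x. scale c (f x))"

definition ind_space ::
  "('g, 'm) monoid_scheme \<Rightarrow> 'g set \<Rightarrow> ('g \<Rightarrow> 'v \<Rightarrow> 'v) \<Rightarrow> ('g \<Rightarrow> 'v::ab_group_add) set" where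
  "ind_space G K \<theta> =
    {f. (\<forall>g. g \<notin> carrier G \<longrightarrow> f g = 0) \<and>
        (\<forall>g\<in>carrier G. \<forall>k\<in>K. f (g \<otimes>\<^bsub>G\<^esub> k) = \<theta> (inv\<^bsub>G\<^esub> k) (f g))}"

definition ind_ip ::
  "('g, 'm) monoid_scheme \<Rightarrow> 'g set \<Rightarrow> ('v \<Rightarrow> 'v \<Rightarrow> complex)
    \<Rightarrow> ('g \<Rightarrow> 'v) \<Rightarrow> ('g \<Rightarrow> 'v) \<Rightarrow> complex" where
  "ind_ip G K ip f f' = (\<Sum>g\<in>carrier G. ip (f g) (f' g)) / of_nat (card K)"

definition ind_rep ::
  "('g, 'm) monoid_scheme \<Rightarrow> 'g \<Rightarrow> ('g \<Rightarrow> 'v::ab_group_add) \<Rightarrow> 'g \<Rightarrow> 'v" where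
  "ind_rep G g f = (\<lambda>x. if x \<in> carrier G then f (inv\<^bsub>G\<^esub> g \<otimes>\<^bsub>G\<^esub> x) else 0)"

definition multiplicity_free_triple ::
  "('g, 'm) monoid_scheme \<Rightarrow> 'g set \<Rightarrow> (complex \<Rightarrow> 'v::ab_group_add \<Rightarrow> 'v)
    \<Rightarrow> ('v \<Rightarrow> 'v \<Rightarrow> complex) \<Rightarrow> ('g \<Rightarrow> 'v \<Rightarrow> 'v) \<Rightarrow> bool" where
  "multiplicity_free_triple G K scale ip \<theta> \<longleftrightarrow>
    multiplicity_free G (fun_scale scale) (ind_space G K \<theta>) (ind_ip G K ip) (ind_rep G)"

definition endomorphisms :: "(complex \<Rightarrow> 'v::ab_group_add \<Rightarrow> 'v) \<Rightarrow> ('v \<Rightarrow> 'v) set" where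
  "endomorphisms scale = {T. Vector_Spaces.linear scale scale T}"

text \<open>The adjoint with respect to \<open>ip\<close>, on a finite-dimensional inner product space that is a
  whole type.\<close>

definition ip_adjoint ::
  "('v \<Rightarrow> 'v \<Rightarrow> complex) \<Rightarrow> ('v \<Rightarrow> 'v) \<Rightarrow> 'v \<Rightarrow> 'v" where
  "ip_adjoint ip T = (THE T'. \<forall>v w. ip (T v) w = ip v (T' w))"

definition algebra_antiautomorphism ::
  "(complex \<Rightarrow> 'v::ab_group_add \<Rightarrow> 'v) \<Rightarrow> (('v \<Rightarrow> 'v) \<Rightarrow> 'v \<Rightarrow> 'v) \<Rightarrow> bool" where
  "algebra_antiautomorphism scale sharp \<longleftrightarrow>
    bij_betw sharp (endomorphisms scale) (endomorphisms scale) \<and>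
    (\<forall>S\<in>endomorphisms scale. \<forall>T\<in>endomorphisms scale. sharp (S + T) = sharp S + sharp T) \<and>
    (\<forall>c. \<forall>T\<in>endomorphisms scale. sharp (fun_scale scale c T) = fun_scale scale c (sharp T)) \<and>
    (\<forall>S\<in>endomorphisms scale. \<forall>T\<in>endomorphisms scale. sharp (S \<circ> T) = sharp T \<circ> sharp S)"

definition group_antiautomorphism :: "('g, 'm) monoid_scheme \<Rightarrow> ('g \<Rightarrow> 'g) \<Rightarrow> bool" where
  "group_antiautomorphism G \<tau> \<longleftrightarrow>
    bij_betw \<tau> (carrier G) (carrier G) \<and>
    (\<forall>g\<in>carrier G. \<forall>h\<in>carrier G. \<tau> (g \<otimes>\<^bsub>G\<^esub> h) = \<tau> h \<otimes>\<^bsub>G\<^esub> \<tau> g)"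

definition double_coset :: "('g, 'm) monoid_scheme \<Rightarrow> 'g set \<Rightarrow> 'g \<Rightarrow> 'g set" where
  "double_coset G K s = K <#>\<^bsub>G\<^esub> (s <#\<^bsub>G\<^esub> K)"

definition double_coset_reps :: "('g, 'm) monoid_scheme \<Rightarrow> 'g set \<Rightarrow> 'g set \<Rightarrow> bool" where
  "double_coset_reps G K \<S> \<longleftrightarrow>
    \<S> \<subseteq> carrier G \<and> (\<forall>g\<in>carrier G. \<exists>!s. s \<in> \<S> \<and> g \<in> double_coset G K s)"

definition conj_subgroup :: "('g, 'm) monoid_scheme \<Rightarrow> 'g set \<Rightarrow> 'g \<Rightarrow> 'g set" where
  "conj_subgroup G K s = K \<inter> ((s <#\<^bsub>G\<^esub> K) #>\<^bsub>G\<^esub> inv\<^bsub>G\<^esub> s)"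

definition conj_rep ::
  "('g, 'm) monoid_scheme \<Rightarrow> ('g \<Rightarrow> 'v \<Rightarrow> 'v) \<Rightarrow> 'g \<Rightarrow> 'g \<Rightarrow> 'v \<Rightarrow> 'v" where
  "conj_rep G \<theta> s x = \<theta> (inv\<^bsub>G\<^esub> s \<otimes>\<^bsub>G\<^esub> x \<otimes>\<^bsub>G\<^esub> s)"

definition mackey_hom ::
  "('g, 'm) monoid_scheme \<Rightarrow> 'g set \<Rightarrow> (complex \<Rightarrow> 'v::ab_group_add \<Rightarrow> 'v)
    \<Rightarrow> ('g \<Rightarrow> 'v \<Rightarrow> 'v) \<Rightarrow> 'g \<Rightarrow> ('v \<Rightarrow> 'v) set" where
  "mackey_hom G K scale \<theta> s =
    intertwiners (conj_subgroup G K s) scale UNIV \<theta> UNIV (conj_rep G \<theta> s)"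

definition mackey_support ::
  "('g, 'm) monoid_scheme \<Rightarrow> 'g set \<Rightarrow> (complex \<Rightarrow> 'v::ab_group_add \<Rightarrow> 'v)
    \<Rightarrow> ('g \<Rightarrow> 'v \<Rightarrow> 'v) \<Rightarrow> 'g set \<Rightarrow> 'g set" where
  "mackey_support G K scale \<theta> \<S> = {s \<in> \<S>. mackey_hom G K scale \<theta> s \<noteq> {0}}"

end

theory Submission
  imports Defs
begin

text \<open>An element \<open>A\<close> of the commutant of the induced representation is a convolution operator with
  kernel \<open>F\<^sub>A : G \<rightarrow> End(V)\<close>, where \<open>F\<^sub>A(k\<^sub>1 g k\<^sub>2) = \<theta>(k\<^sub>2\<inverse>) F\<^sub>A(g) \<theta>(k\<^sub>1\<inverse>)\<close>; in particular
  \<open>F\<^sub>A(s)\<close> intertwines \<open>\<theta>\<close> and \<open>\<theta>\<^sup>s\<close> on \<open>K\<^sub>s\<close>. The hypotheses give \<open>F\<^sub>A(\<tau>(g)) = F\<^sub>A(g)\<^sup>\<sharp>\<close> for all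
  \<open>g\<close>: this is checked on \<open>\<S>\<close>, where \<open>\<tau>\<close> maps the double cosets of \<open>\<S>\<^sub>0\<close> to themselves and hence
  permutes the others, on which all kernels vanish. Since \<open>\<tau>\<close> and \<open>\<sharp>\<close> both reverse products,
  \<open>F\<^sub>A\<^sub>B(g)\<^sup>\<sharp> = F\<^sub>A\<^sub>B(\<tau>(g)) = F\<^sub>B\<^sub>A(g)\<^sup>\<sharp>\<close>, so the commutant is commutative, which forces the
  irreducible constituents to be pairwise inequivalent.\<close>

section \<open>Orthogonal complements and irreducible decompositions\<close>

lemma (in vector_space) finite_basis_in_span:
  assumes "subspace W" "finite C" "W \<subseteq> span C"
  obtains B where "finite B" "B \<subseteq> W" "independent B" "span B = W"
proof -
  obtain B where B: "B \<subseteq> W" "independent B" "W \<subseteq> span B"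
    using maximal_independent_subset[of W] by blast
  then have "finite B"
    using independent_span_bound[OF assms(2) B(2)] assms(3) by blast
  moreover have "span B = W"
    using B assms(1) by (simp add: span_minimal subset_antisym)
  ultimately show ?thesis
    using B that by blast
qed

section \<open>Orthogonal complements in a finite-dimensional inner product space\<close>

context fin_dim_inner_space
begin

lemma V_closed:
  "0 \<in> V" "x \<in> V \<Longrightarrow> y \<in> V \<Longrightarrow> x + y \<in> V" "x \<in> V \<Longrightarrow> y \<in> V \<Longrightarrow> x - y \<in> V"
  "x \<in> V \<Longrightarrow> scale c x \<in> V"
  using subspace_V by (auto intro: subspace_0 subspace_add subspace_diff subspace_scale)

lemma ip_zero_left: "y \<in> V \<Longrightarrow> ip 0 y = 0"
  using ip_scale_left[of y y 0] by simp

lemma ip_diff_left: "\<lbrakk>x \<in> V; y \<in> V; z \<in> V\<rbrakk> \<Longrightarrow> ip (x - y) z = ip x z - ip y z"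
  using ip_add_left[of "x - y" y z] by (simp add: V_closed)

lemma ip_add_right: "\<lbrakk>x \<in> V; y \<in> V; z \<in> V\<rbrakk> \<Longrightarrow> ip z (x + y) = ip z x + ip z y"
  by (metis ip_add_left ip_commute complex_cnj_add V_closed(2))

lemma ip_scale_right: "\<lbrakk>x \<in> V; y \<in> V\<rbrakk> \<Longrightarrow> ip x (scale c y) = cnj c * ip x y"
  by (metis ip_scale_left ip_commute complex_cnj_mult V_closed(4))

lemma ip_zero_right: "y \<in> V \<Longrightarrow> ip y 0 = 0"
  using ip_scale_right[of y y 0] by simp

lemma ip_diff_right: "\<lbrakk>x \<in> V; y \<in> V; z \<in> V\<rbrakk> \<Longrightarrow> ip z (x - y) = ip z x - ip z y"
  using ip_add_right[of "x - y" y z] by (simp add: V_closed)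

lemma ip_self_eq_0_iff: "x \<in> V \<Longrightarrow> ip x x = 0 \<longleftrightarrow> x = 0"
  using ip_pos[of x] ip_zero_left by (cases "x = 0") auto

lemma finite_basis_subspace:
  assumes "subspace W" "W \<subseteq> V"
  obtains B where "finite B" "B \<subseteq> W" "independent B" "span B = W"
  using fin_dim finite_basis_in_span[OF assms(1)] assms(2) by metis

text \<open>A vector of \<open>V\<close> outside \<open>W\<close> extends a basis of
  \<open>W\<close> to a strictly longer independent family. This is the decrease behind the
  induction on dimension in \<open>irreducible_decomposition_exists\<close>.\<close>

lemma dim_psubspace_less:
  assumes "subspace W" "W \<subset> V"
  shows "dim W < dim V"
proof -
  obtain B where B: "finite B" "B \<subseteq> W" "independent B" "span B = W"
    using finite_basis_subspace[of W] assms by blast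
  obtain C where C: "finite C" "C \<subseteq> V" "independent C" "span C = V"
    using finite_basis_subspace[of V] subspace_V by blast
  obtain x where x: "x \<in> V" "x \<notin> W"
    using assms by blast
  then have "independent (insert x B)" "x \<notin> B"
    using B independent_insert[of x B] by auto
  moreover have "insert x B \<subseteq> span C"
    using x B C assms by auto
  ultimately have "Suc (card B) \<le> card C"
    using independent_span_bound[OF C(1), of "insert x B"] B(1) by simp
  moreover have "dim W = card B" "dim V = card C"
    using B C dim_eq_card by (metis span_span)+
  ultimately show ?thesis by simp
qed

definition orthogonal_complement :: "'v set \<Rightarrow> 'v set" where
  "orthogonal_complement W = {v \<in> V. \<forall>w\<in>W. ip v w = 0}"

lemma subspace_orthogonal_complement:
  "W \<subseteq> V \<Longrightarrow> subspace (orthogonal_complement W)"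
  unfolding orthogonal_complement_def
  by (intro subspaceI) (auto simp: V_closed ip_zero_left ip_add_left ip_scale_left subset_iff)

text \<open>Gram-Schmidt: the new vector \<open>b\<close> is made orthogonal to
  \<open>span B\<close>, and the projection \<open>q\<close> of \<open>v\<close> onto
  \<open>span B\<close> is then corrected along this new direction.\<close>

lemma orthogonal_projection_span_exists:
  assumes "finite B" "B \<subseteq> V" "v \<in> V"
  shows "\<exists>w\<in>span B. \<forall>u\<in>span B. ip (v - w) u = 0"
  using assms
proof (induction B arbitrary: v rule: finite_induct)
  case empty
  then show ?case by (auto simp: ip_zero_right)
next
  case (insert b B)
  have sV: "span (insert b B) \<subseteq> V"
    using insert.prems span_minimal[OF _ subspace_V] by auto
  have sub: "span B \<subseteq> span (insert b B)"
    by (rule span_mono) auto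
  obtain p where p: "p \<in> span B" "\<And>u. u \<in> span B \<Longrightarrow> ip (b - p) u = 0"
    using insert.IH[of b] insert.prems by auto
  obtain q where q: "q \<in> span B" "\<And>u. u \<in> span B \<Longrightarrow> ip (v - q) u = 0"
    using insert.IH[of v] insert.prems by auto
  define b' where "b' = b - p"
  \<comment> \<open>If \<open>b' = 0\<close>, the division yields 0; this is harmless, since
    \<open>b\<close> then already lies in \<open>span B\<close>.\<close>
  define c where "c = ip (v - q) b' / ip b' b'"
  have bin: "b' \<in> span (insert b B)"
    unfolding b'_def using p(1) sub by (auto intro: span_diff span_base)
  have inV: "b' \<in> V" "p \<in> V" "q \<in> V" "v - q \<in> V" "v \<in> V"
    using subsetD[OF sV] bin p(1) q(1) subsetD[OF sub] insert.prems
    by (simp_all add: V_closed)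
  have orth_b': "ip (v - q - scale c b') b' = 0"
    using inV by (cases "b' = 0")
      (auto simp: ip_zero_right V_closed c_def ip_diff_left ip_scale_left ip_self_eq_0_iff)
  have "ip (v - (q + scale c b')) u = 0" if u: "u \<in> span (insert b B)" for u
  proof -
    obtain k where k: "u - scale k b \<in> span B"
      using u by (auto simp: span_insert)
    \<comment> \<open>Trading the multiple of \<open>b\<close> in \<open>u\<close> for the same
      multiple of \<open>b'\<close> leaves a remainder in \<open>span B\<close>, so orthogonality
      has to be tested only against \<open>span B\<close> and \<open>b'\<close>.\<close>
    define u' where "u' = u - scale k b'"
    have "u' = (u - scale k b) + scale k p"
      by (simp add: u'_def b'_def scale_right_diff_distrib)
    then have u': "u' \<in> span B" "u' \<in> V"
      using k p sub sV by (auto intro!: span_add span_scale)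
    have "ip (v - q - scale c b') u' = 0"
      using p(2)[OF u'(1)] q(2)[OF u'(1)] inV u'
      by (simp add: ip_diff_left ip_scale_left V_closed b'_def[symmetric])
    moreover have "u = u' + scale k b'"
      by (simp add: u'_def)
    ultimately show ?thesis
      using orth_b' inV u'
      by (simp add: ip_add_right ip_scale_right V_closed diff_diff_eq[symmetric])
  qed
  moreover have "q + scale c b' \<in> span (insert b B)"
    using q(1) sub bin by (auto intro: span_add span_scale)
  ultimately show ?case by blast
qed

lemma orthogonal_splitting:
  assumes "subspace W" "W \<subseteq> V" "v \<in> V"
  obtains w where "w \<in> W" "v - w \<in> orthogonal_complement W"
proof -
  obtain B where B: "finite B" "B \<subseteq> W" "span B = W"
    using finite_basis_subspace[OF assms(1,2)] by metis
  then obtain w where "w \<in> W" "\<forall>u\<in>W. ip (v - w) u = 0"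
    using orthogonal_projection_span_exists[of B v] assms by auto
  then show ?thesis
    using that[of w] assms by (auto simp: orthogonal_complement_def V_closed subset_iff)
qed

lemma orthogonal_splitting_unique:
  assumes "subspace W" "W \<subseteq> V"
    and "w \<in> W" "w' \<in> W"
    and "v - w \<in> orthogonal_complement W" "v - w' \<in> orthogonal_complement W"
  shows "w = w'"
proof -
  have "(v - w) - (v - w') \<in> orthogonal_complement W"
    using assms subspace_orthogonal_complement subspace_diff by blast
  moreover have "w' - w \<in> W"
    using assms by (simp add: subspace_diff)
  ultimately have "ip (w' - w) (w' - w) = 0" "w' - w \<in> V"
    using assms by (auto simp: orthogonal_complement_def)
  then show ?thesis
    using ip_self_eq_0_iff[of "w' - w"] by simp
qed

text \<open>Restricted to \<open>V\<close> because \<open>intertwiners\<close> consists of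
  extensional maps.\<close>

definition orthogonal_projection :: "'v set \<Rightarrow> 'v \<Rightarrow> 'v" where
  "orthogonal_projection W =
    restrict (\<lambda>v. THE w. w \<in> W \<and> v - w \<in> orthogonal_complement W) V"

lemma orthogonal_projection_eqI:
  assumes "subspace W" "W \<subseteq> V" "v \<in> V" "w \<in> W" "v - w \<in> orthogonal_complement W"
  shows "orthogonal_projection W v = w"
  unfolding orthogonal_projection_def
  using assms by (auto intro!: the_equality orthogonal_splitting_unique[of W])

lemma orthogonal_projection_in:
  assumes "subspace W" "W \<subseteq> V" "v \<in> V"
  shows "orthogonal_projection W v \<in> W"
    and "v - orthogonal_projection W v \<in> orthogonal_complement W"
  using orthogonal_splitting[OF assms] orthogonal_projection_eqI[OF assms] by metis+

end

section \<open>Subrepresentations and equivariant projections\<close>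

context unitary_rep
begin

lemma unitary_rep_subspace:
  assumes "subspace W" "W \<subseteq> V" "\<forall>g\<in>carrier G. \<rho> g ` W \<subseteq> W"
  shows "unitary_rep G scale W ip \<rho>"
proof
  show "\<exists>B. finite B \<and> span B = W"
    using finite_basis_subspace[OF assms(1,2)] by metis
  show "\<rho> g v \<in> W" if "g \<in> carrier G" "v \<in> W" for g v
    using that assms(3) by blast
  show "ip x y = cnj (ip y x)" if "x \<in> W" "y \<in> W" for x y
    using that by (intro ip_commute subsetD[OF assms(2)])
qed (simp_all add: assms(1) subsetD[OF assms(2)] ip_add_left ip_scale_left rep_add rep_scale
       rep_one rep_mult rep_unitary ip_pos)

lemma rep_diff: "\<lbrakk>g \<in> carrier G; v \<in> V; w \<in> V\<rbrakk> \<Longrightarrow> \<rho> g (v - w) = \<rho> g v - \<rho> g w"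
  using rep_add[of g "v - w" w] by (simp add: V_closed)

text \<open>Unitarity moves \<open>\<rho> g\<close> into the other argument as
  \<open>\<rho> (inv g)\<close>, which preserves \<open>W\<close>.\<close>

lemma orthogonal_complement_invariant:
  assumes "W \<subseteq> V" "\<forall>g\<in>carrier G. \<rho> g ` W \<subseteq> W" "g \<in> carrier G"
    and "v \<in> orthogonal_complement W"
  shows "\<rho> g v \<in> orthogonal_complement W"
proof -
  have "ip (\<rho> g v) w = 0" if "w \<in> W" for w
  proof -
    have inW: "\<rho> (inv g) w \<in> W" "w \<in> V"
      using assms that by auto
    have "w = \<rho> g (\<rho> (inv g) w)"
      using assms inW rep_mult[of g "inv g" w] rep_one[of w] by simp
    then have "ip (\<rho> g v) w = ip v (\<rho> (inv g) w)"
      using assms inW rep_unitary[of g v "\<rho> (inv g) w"]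
      by (auto simp: orthogonal_complement_def)
    then show ?thesis
      using assms inW by (auto simp: orthogonal_complement_def)
  qed
  then show ?thesis
    using assms rep_closed by (auto simp: orthogonal_complement_def)
qed

text \<open>By uniqueness of the splitting, each identity only needs the proposed value to lie in
  \<open>W\<close> and the remainder in the complement. For equivariance this holds because both
  subspaces are invariant.\<close>

lemma orthogonal_projection_intertwines:
  assumes "subspace W" "W \<subseteq> V" "\<forall>g\<in>carrier G. \<rho> g ` W \<subseteq> W"
  shows "orthogonal_projection W \<in> intertwiners (carrier G) scale V \<rho> W \<rho>"
proof -
  note P = orthogonal_projection_in[OF assms(1,2)]
  note eqI = orthogonal_projection_eqI[OF assms(1,2)]
  note C = subspace_orthogonal_complement[OF assms(2)]
  have "orthogonal_projection W (v + w) = orthogonal_projection W v + orthogonal_projection W w"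
    if "v \<in> V" "w \<in> V" for v w
    using that P[of v] P[of w] subspace_add[OF assms(1)] subspace_add[OF C]
    by (intro eqI) (auto simp: V_closed add_diff_add)
  moreover have "orthogonal_projection W (scale c v) = scale c (orthogonal_projection W v)"
    if "v \<in> V" for c v
    using that P[of v] subspace_scale[OF assms(1)] subspace_scale[OF C]
    by (intro eqI) (auto simp: V_closed scale_right_diff_distrib[symmetric])
  moreover have "orthogonal_projection W (\<rho> g v) = \<rho> g (orthogonal_projection W v)"
    if "g \<in> carrier G" "v \<in> V" for g v
  proof (intro eqI)
    have "orthogonal_projection W v \<in> V"
      using P that assms by auto
    then show "\<rho> g v - \<rho> g (orthogonal_projection W v) \<in> orthogonal_complement W"
      using orthogonal_complement_invariant[OF assms(2,3) that(1) P(2)[OF that(2)]] that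
      by (simp add: rep_diff)
    show "\<rho> g (orthogonal_projection W v) \<in> W"
      using that P(1)[of v] assms(3) by blast
  qed (use that rep_closed in auto)
  ultimately show ?thesis
    using P(1) by (auto simp: intertwiners_def orthogonal_projection_def)
qed

end

text \<open>Complete reducibility, by strong induction on the dimension: a proper nonzero invariant
  subspace and its orthogonal complement are both smaller, and their decompositions are
  united.\<close>

lemma irreducible_decomposition_exists:
  assumes "unitary_rep G scale V ip \<rho>"
  shows "\<exists>\<W>. irreducible_decomposition G scale V ip \<rho> \<W>"
  using assms
proof (induction "vector_space.dim scale V" arbitrary: V rule: less_induct)
  case less
  interpret unitary_rep G scale V ip \<rho> by (rule less.prems)
  consider "V = {0}" | "irreducible_rep G scale V ip \<rho>"
    | W where "subspace W" "W \<subseteq> V" "\<forall>g\<in>carrier G. \<rho> g ` W \<subseteq> W" "W \<noteq> {0}" "W \<noteq> V"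
    using irreducible_rep.intro[OF less.prems irreducible_rep_axioms.intro] by metis
  then show ?case
  proof cases
    case 1
    then have "irreducible_decomposition G scale V ip \<rho> {}"
      by (simp add: irreducible_decomposition_def)
    then show ?thesis by blast
  next
    case 2
    then have "irreducible_decomposition G scale V ip \<rho> {V}"
      using subspace_V by (simp add: irreducible_decomposition_def)
    then show ?thesis by blast
  next
    case (3 W)
    define U where "U = orthogonal_complement W"
    have U: "subspace U" "U \<subseteq> V" "\<forall>g\<in>carrier G. \<rho> g ` U \<subseteq> U"
      using subspace_orthogonal_complement[OF 3(2)] orthogonal_complement_invariant[OF 3(2,3)]
      by (auto simp: U_def orthogonal_complement_def)
    \<comment> \<open>Otherwise every vector of \<open>W\<close> would be orthogonal to itself,
      forcing \<open>W = {0}\<close>.\<close>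
    have "U \<noteq> V"
    proof
      assume "U = V"
      then have "ip w w = 0" if "w \<in> W" for w
        using that 3(2) by (auto simp: U_def orthogonal_complement_def)
      then have "W \<subseteq> {0}"
        using 3(2) ip_self_eq_0_iff by blast
      then show False
        using 3(1,4) subspace_0 by blast
    qed
    then have "dim W < dim V" "dim U < dim V"
      using dim_psubspace_less[of W] dim_psubspace_less[of U] 3 U by auto
    then obtain \<A> \<B> where A: "irreducible_decomposition G scale W ip \<rho> \<A>"
      and B: "irreducible_decomposition G scale U ip \<rho> \<B>"
      using less.hyps[OF _ unitary_rep_subspace[OF 3(1-3)]]
        less.hyps[OF _ unitary_rep_subspace[OF U]] by blast
    have orth: "ip v w = 0 \<and> ip w v = 0" if "v \<in> W" "w \<in> U" for v w
    proof -
      have "ip w v = 0" "v \<in> V" "w \<in> V"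
        using that 3(2) by (auto simp: U_def orthogonal_complement_def)
      then show ?thesis
        using ip_commute[of v w] by simp
    qed
    have sub: "X \<subseteq> W" if "X \<in> \<A>" for X
      using A that by (simp add: irreducible_decomposition_def)
    have sub': "X \<subseteq> U" if "X \<in> \<B>" for X
      using B that by (simp add: irreducible_decomposition_def)
    have span: "span (\<Union>\<A>) = W" "span (\<Union>\<B>) = U"
      using A B by (simp_all add: irreducible_decomposition_def)
    have "span (\<Union>(\<A> \<union> \<B>)) = V"
    proof
      show "span (\<Union>(\<A> \<union> \<B>)) \<subseteq> V"
        using sub sub' 3(2) U(2) by (intro span_minimal subspace_V) blast
    next
      show "V \<subseteq> span (\<Union>(\<A> \<union> \<B>))"
      proof
        fix v assume "v \<in> V"
        then obtain w where w: "w \<in> W" "v - w \<in> U"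
          using orthogonal_splitting[OF 3(1,2)] U_def by blast
        have "W \<subseteq> span (\<Union>(\<A> \<union> \<B>))" "U \<subseteq> span (\<Union>(\<A> \<union> \<B>))"
          unfolding span[symmetric] by (intro span_mono; blast)+
        then have "w + (v - w) \<in> span (\<Union>(\<A> \<union> \<B>))"
          using w by (intro span_add) auto
        then show "v \<in> span (\<Union>(\<A> \<union> \<B>))" by simp
      qed
    qed
    moreover have "ip v w = 0"
      if *: "X \<in> \<A> \<union> \<B>" "Y \<in> \<A> \<union> \<B>" "X \<noteq> Y" "v \<in> X" "w \<in> Y" for X Y v w
    proof -
      consider "X \<in> \<A>" "Y \<in> \<A>" | "X \<in> \<B>" "Y \<in> \<B>"
        | "v \<in> W" "w \<in> U" | "v \<in> U" "w \<in> W"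
        using * sub sub' by blast
      then show ?thesis
        by cases (use * A B orth in \<open>simp_all add: irreducible_decomposition_def\<close>)
    qed
    moreover have "finite (\<A> \<union> \<B>)"
      "\<forall>X\<in>\<A> \<union> \<B>. irreducible_rep G scale X ip \<rho>"
      using A B by (auto simp: irreducible_decomposition_def)
    moreover have "\<forall>X\<in>\<A> \<union> \<B>. X \<subseteq> V"
      using sub sub' 3(2) U(2) by blast
    ultimately have "irreducible_decomposition G scale V ip \<rho> (\<A> \<union> \<B>)"
      unfolding irreducible_decomposition_def by simp
    then show ?thesis by blast
  qed
qed

text \<open>If \<open>T : W \<rightarrow> W'\<close> were an equivalence of distinct summands, \<open>T \<circ> P\<^sub>W\<close> and \<open>P\<^sub>W\<close> would be
  intertwiners that do not commute, since \<open>P\<^sub>W \<circ> T \<circ> P\<^sub>W = 0\<close>.\<close>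

lemma (in unitary_rep) multiplicity_free_if_commutative:
  assumes comm: "\<And>A B v. \<lbrakk>A \<in> intertwiners (carrier G) scale V \<rho> V \<rho>;
      B \<in> intertwiners (carrier G) scale V \<rho> V \<rho>; v \<in> V\<rbrakk> \<Longrightarrow> A (B v) = B (A v)"
  shows "multiplicity_free G scale V ip \<rho>"
proof -
  obtain \<W> where dec: "irreducible_decomposition G scale V ip \<rho> \<W>"
    using irreducible_decomposition_exists unitary_rep_axioms by blast
  have "\<not> equivalent_reps G scale W \<rho> W' \<rho>" if W: "W \<in> \<W>" "W' \<in> \<W>" "W \<noteq> W'" for W W'
  proof
    assume "equivalent_reps G scale W \<rho> W' \<rho>"
    then obtain T where T: "T \<in> intertwiners (carrier G) scale W \<rho> W' \<rho>" "bij_betw T W W'"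
      by (auto simp: equivalent_reps_def)
    interpret W: irreducible_rep G scale W ip \<rho>
      using dec W by (simp add: irreducible_decomposition_def)
    have sub: "W \<subseteq> V" "W' \<subseteq> V"
      using dec W by (auto simp: irreducible_decomposition_def)
    have "\<forall>v\<in>W'. \<forall>w\<in>W. ip v w = 0"
      using dec W(1) W(2) W(3)[symmetric] unfolding irreducible_decomposition_def by simp
    then have orth: "W' \<subseteq> orthogonal_complement W"
      using sub by (auto simp: orthogonal_complement_def)
    define P where "P = orthogonal_projection W"
    have P: "P \<in> intertwiners (carrier G) scale V \<rho> W \<rho>"
      unfolding P_def using W.subspace_V sub W.rep_closed
      by (intro orthogonal_projection_intertwines) auto
    have "P \<in> intertwiners (carrier G) scale V \<rho> V \<rho>"
      using P sub by (auto simp: intertwiners_def)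
    moreover have "restrict (T \<circ> P) V \<in> intertwiners (carrier G) scale V \<rho> V \<rho>"
      using PiE_mem[of P V "\<lambda>_. W"] P T(1) sub
      by (simp add: intertwiners_def PiE_iff V_closed rep_closed subset_iff)
    moreover obtain w where w: "w \<in> W" "w \<noteq> 0"
      using W.nonzero subspace_0[OF W.subspace_V] by blast
    \<comment> \<open>Since \<open>P w = w\<close>, the left side is \<open>T w\<close> and the
      right side is \<open>P (T w)\<close>, which vanishes because \<open>W'\<close> is orthogonal
      to \<open>W\<close>.\<close>
    ultimately have "restrict (T \<circ> P) V (P w) = P (restrict (T \<circ> P) V w)"
      using comm sub by blast
    moreover have "P w = w"
      unfolding P_def using w sub W.subspace_V subspace_orthogonal_complement[OF sub(1)]
      by (intro orthogonal_projection_eqI) (auto intro: subspace_0)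
    moreover have Tw: "T w \<in> W'"
      using T w by (auto simp: intertwiners_def)
    moreover have "P (T w) = 0"
      unfolding P_def using Tw w sub orth W.subspace_V
      by (intro orthogonal_projection_eqI) (auto intro: subspace_0)
    ultimately have "T w = 0"
      using w sub by auto
    \<comment> \<open>This says that \<open>T\<close> sends 0 to 0, so \<open>T w = 0\<close>
      contradicts injectivity on \<open>W\<close>.\<close>
    moreover have "T (scale 0 w) = scale 0 (T w)"
      using T(1) w(1) unfolding intertwiners_def by blast
    ultimately have "T w = T 0" by simp
    then show False
      using w subspace_0[OF W.subspace_V] bij_betw_imp_inj_on[OF T(2)] by (auto dest: inj_onD)
  qed
  then show ?thesis
    using dec by (auto simp: multiplicity_free_def)
qed

section \<open>The commutant of an induced representation\<close>

lemma sum_fun_apply: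
  fixes f :: "'i \<Rightarrow> 'a \<Rightarrow> 'b::ab_group_add"
  shows "(\<Sum>i\<in>I. f i) x = (\<Sum>i\<in>I. f i x)"
  by (induction I rule: infinite_finite_induct) auto

lemma vector_space_fun_scale:
  assumes "vector_space scale"
  shows "vector_space (fun_scale scale)"
proof -
  interpret vector_space scale by (rule assms)
  show ?thesis
    by unfold_locales (auto simp: fun_scale_def scale_right_distrib scale_left_distrib)
qed

section \<open>The induced representation as a unitary representation\<close>

locale induced = group G + inner: unitary_rep "G\<lparr>carrier := K\<rparr>" scale UNIV ip \<theta>
  for G (structure) and K and scale :: "complex \<Rightarrow> 'v::ab_group_add \<Rightarrow> 'v" and ip \<theta> +
  assumes finite_carrier: "finite (carrier G)" and subgroup_K: "subgroup K G"
begin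

abbreviation "I \<equiv> ind_space G K \<theta>"

abbreviation "commutant \<equiv>
  intertwiners (carrier G) (fun_scale scale) I (ind_rep G) I (ind_rep G)"

sublocale ind: vector_space "fun_scale scale"
  by (rule vector_space_fun_scale[OF inner.vector_space_axioms])

lemma K_closed [simp]:
  "k \<in> K \<Longrightarrow> k \<in> carrier G" "k \<in> K \<Longrightarrow> inv k \<in> K" "k \<in> K \<Longrightarrow> l \<in> K \<Longrightarrow> k \<otimes> l \<in> K" "\<one> \<in> K"
  using subgroup_K subgroup.mem_carrier subgroup.m_inv_closed subgroup.m_closed subgroup.one_closed
  by metis+

lemma finite_K: "finite K"
  using finite_carrier by (rule rev_finite_subset) auto

text \<open>The averaging formulas below keep the factor \<open>card K\<close> on their left side;
  this fact allows it to be cancelled at the end.\<close>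

lemma card_K: "of_nat (card K) \<noteq> (0::complex)"
  using finite_K K_closed(4) by (auto simp del: K_closed)

lemma mult_in_K_iff:
  assumes "g \<in> carrier G" "k \<in> K"
  shows "g \<otimes> k \<in> K \<longleftrightarrow> g \<in> K" "k \<otimes> g \<in> K \<longleftrightarrow> g \<in> K"
proof -
  have "g = (g \<otimes> k) \<otimes> inv k" "g = inv k \<otimes> (k \<otimes> g)"
    using assms by (simp_all add: m_assoc m_assoc[symmetric])
  then show "g \<otimes> k \<in> K \<longleftrightarrow> g \<in> K" "k \<otimes> g \<in> K \<longleftrightarrow> g \<in> K"
    using assms by (metis K_closed)+
qed

lemma \<theta>_one [simp]: "\<theta> \<one> v = v"
  using inner.rep_one by simp

lemma \<theta>_mult: "k \<in> K \<Longrightarrow> l \<in> K \<Longrightarrow> \<theta> (k \<otimes> l) v = \<theta> k (\<theta> l v)"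
  using inner.rep_mult by simp

lemma \<theta>_add: "k \<in> K \<Longrightarrow> \<theta> k (v + w) = \<theta> k v + \<theta> k w"
  using inner.rep_add by simp

lemma \<theta>_scale: "k \<in> K \<Longrightarrow> \<theta> k (scale c v) = scale c (\<theta> k v)"
  using inner.rep_scale by simp

lemma \<theta>_zero: "k \<in> K \<Longrightarrow> \<theta> k 0 = 0"
  using \<theta>_scale[of k 0 0] by simp

lemma ind_space_outside: "f \<in> I \<Longrightarrow> g \<notin> carrier G \<Longrightarrow> f g = 0"
  by (simp add: ind_space_def)

lemma ind_space_mult: "f \<in> I \<Longrightarrow> g \<in> carrier G \<Longrightarrow> k \<in> K \<Longrightarrow> f (g \<otimes> k) = \<theta> (inv k) (f g)"
  by (simp add: ind_space_def)

lemma subspace_ind_space: "ind.subspace I"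
  by (rule ind.subspaceI) (auto simp: ind_space_def fun_scale_def \<theta>_zero \<theta>_add \<theta>_scale)

text \<open>A function on the finite group is the sum of its point masses, and these are spanned by
  the point masses with values in a finite spanning set \<open>B\<close>.\<close>

lemma ind_space_fin_dim: "\<exists>B. finite B \<and> ind.span B = I"
proof -
  obtain B where B: "finite B" "inner.span B = UNIV"
    using inner.fin_dim by blast
  define point where "point g v = (\<lambda>x. if x = g then v else 0)" for g :: 'a and v :: 'v
  define E where "E = (\<lambda>(g, b). point g b) ` (carrier G \<times> B)"
  have point: "point g v \<in> ind.span E" if g: "g \<in> carrier G" for g v
  proof -
    have "v \<in> inner.span B" using B by simp
    then show ?thesis
    proof (induction rule: inner.span_induct_alt)
      case base
      have "point g 0 = 0" by (auto simp: point_def)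
      then show ?case using ind.span_zero[of E] by metis
    next
      case (step c b w)
      have "point g (scale c b + w) = fun_scale scale c (point g b) + point g w"
        by (auto simp: point_def fun_scale_def)
      moreover have "point g b \<in> ind.span E"
        using g step by (auto simp: E_def intro!: ind.span_base)
      ultimately show ?case
        using step ind.span_add ind.span_scale by metis
    qed
  qed
  have "I \<subseteq> ind.span E"
  proof
    fix f assume f: "f \<in> I"
    have "f = (\<Sum>g\<in>carrier G. point g (f g))"
      using finite_carrier ind_space_outside[OF f]
      by (auto simp: sum_fun_apply point_def)
    then show "f \<in> ind.span E"
      using ind.span_sum[of "carrier G" "\<lambda>g. point g (f g)" E] point by simp
  qed
  moreover have "finite E"
    using B finite_carrier by (simp add: E_def)
  \<comment> \<open>Point masses need not satisfy the covariance under \<open>K\<close>, so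
    \<open>E\<close> need not lie in \<open>I\<close>; a basis inside \<open>I\<close> is extracted
    instead.\<close>
  ultimately show ?thesis
    using ind.finite_basis_in_span[OF subspace_ind_space] by metis
qed

lemma sum_translate:
  assumes "g \<in> carrier G"
  shows "(\<Sum>x\<in>carrier G. F (inv g \<otimes> x)) = (\<Sum>x\<in>carrier G. F x)"
  using assms
  by (intro sum.reindex_bij_witness[where i = "\<lambda>x. g \<otimes> x" and j = "\<lambda>x. inv g \<otimes> x"])
    (simp_all add: m_assoc[symmetric])

lemma unitary_rep_ind:
  "unitary_rep G (fun_scale scale) I (ind_ip G K ip) (ind_rep G)"
proof
  show "ind.subspace I" by (rule subspace_ind_space)
  show "\<exists>B. finite B \<and> ind.span B = I" by (rule ind_space_fin_dim)
  show "ind_ip G K ip (x + y) z = ind_ip G K ip x z + ind_ip G K ip y z" for x y z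
    by (simp add: ind_ip_def inner.ip_add_left sum.distrib add_divide_distrib)
  show "ind_ip G K ip (fun_scale scale c x) y = c * ind_ip G K ip x y" for c x y
    by (simp add: ind_ip_def fun_scale_def inner.ip_scale_left sum_distrib_left)
  show "ind_ip G K ip x y = cnj (ind_ip G K ip y x)" for x y
    by (simp add: ind_ip_def inner.ip_commute[symmetric])
  show "0 < Re (ind_ip G K ip x x)" if x: "x \<in> I" "x \<noteq> 0" for x
  proof -
    \<comment> \<open>Such a \<open>g\<close> lies in the carrier, because functions in
      \<open>I\<close> vanish elsewhere; its summand makes the sum strictly positive.\<close>
    obtain g where g: "x g \<noteq> 0" using x(2) by (auto simp: fun_eq_iff)
    have nonneg: "0 \<le> Re (ip v v)" for v
      using inner.ip_pos[of v] inner.ip_zero_left[of 0] by (cases "v = 0") auto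
    have "0 < (\<Sum>g\<in>carrier G. Re (ip (x g) (x g)))"
      using g inner.ip_pos[of "x g"] ind_space_outside[OF x(1)] finite_carrier nonneg
      by (intro sum_pos2[of _ g]) auto
    then show ?thesis
      using card_K by (simp add: ind_ip_def Re_divide_of_nat)
  qed
  fix g assume g: "g \<in> carrier G"
  show "ind_rep G g f \<in> I" if f: "f \<in> I" for f
    using f g by (auto simp: ind_space_def ind_rep_def m_assoc[symmetric])
  show "ind_rep G g (f + f') = ind_rep G g f + ind_rep G g f'" for f f'
    by (auto simp: ind_rep_def)
  show "ind_rep G g (fun_scale scale c f) = fun_scale scale c (ind_rep G g f)" for c f
    by (auto simp: ind_rep_def fun_scale_def)
  show "ind_rep G (g \<otimes> h) f = ind_rep G g (ind_rep G h f)" if "h \<in> carrier G" for h f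
    using g that by (auto simp: ind_rep_def inv_mult_group m_assoc)
  show "ind_ip G K ip (ind_rep G g f) (ind_rep G g f') = ind_ip G K ip f f'" for f f'
    using sum_translate[OF g, of "\<lambda>x. ip (f x) (f' x)"] by (simp add: ind_ip_def ind_rep_def)
next
  show "ind_rep G \<one> f = f" if "f \<in> I" for f
    using ind_space_outside[OF that] by (auto simp: ind_rep_def)
qed

sublocale ind: unitary_rep G "fun_scale scale" I "ind_ip G K ip" "ind_rep G"
  by (rule unitary_rep_ind)

section \<open>Functions supported on \<open>K\<close>: the copy of \<open>\<theta>\<close> inside
  the induced space\<close>

definition delta :: "'v \<Rightarrow> 'a \<Rightarrow> 'v" where
  "delta v = (\<lambda>x. if x \<in> K then \<theta> (inv x) v else 0)"

lemma delta_in_ind_space: "delta v \<in> I"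
  by (auto simp: ind_space_def delta_def mult_in_K_iff inv_mult_group \<theta>_mult \<theta>_zero)

lemma delta_add: "delta (v + w) = delta v + delta w"
  by (auto simp: delta_def \<theta>_add)

lemma delta_scale: "delta (scale c v) = fun_scale scale c (delta v)"
  by (auto simp: delta_def fun_scale_def \<theta>_scale)

lemma ind_rep_delta: "k \<in> K \<Longrightarrow> ind_rep G k (delta v) = delta (\<theta> k v)"
  by (auto simp: ind_rep_def delta_def mult_in_K_iff inv_mult_group \<theta>_mult)

text \<open>A function \<open>f\<close> in the induced space is the average over \<open>h\<close> of the translates of
  \<open>f h\<close> placed on the coset \<open>hK\<close>; each coset is counted \<open>card K\<close> times.\<close>

lemma ind_space_expansion:
  assumes f: "f \<in> I"
  shows "fun_scale scale (of_nat (card K)) f = (\<Sum>h\<in>carrier G. ind_rep G h (delta (f h)))"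
proof
  fix x
  show "fun_scale scale (of_nat (card K)) f x = (\<Sum>h\<in>carrier G. ind_rep G h (delta (f h))) x"
  proof (cases "x \<in> carrier G")
    case False
    then show ?thesis
      using ind_space_outside[OF f] by (simp add: fun_scale_def sum_fun_apply ind_rep_def)
  next
    case x: True
    \<comment> \<open>These are the \<open>h\<close> whose coset \<open>hK\<close> contains
      \<open>x\<close>. The map from \<open>h\<close> to \<open>inv h \<otimes> x\<close> identifies
      them with \<open>K\<close>, and each contributes \<open>f x\<close> by covariance of
      \<open>f\<close>.\<close>
    define H where "H = {h \<in> carrier G. inv h \<otimes> x \<in> K}"
    have "card H = card K"
    proof (rule bij_betw_same_card)
      show "bij_betw (\<lambda>h. inv h \<otimes> x) H K"
        by (rule bij_betw_byWitness[where f' = "\<lambda>k. x \<otimes> inv k"])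
          (use x in \<open>auto simp: H_def inv_mult_group m_assoc[symmetric]\<close>,
           use x in \<open>auto simp: m_assoc\<close>)
    qed
    have "delta (f h) (inv h \<otimes> x) = f x" if "h \<in> H" for h
      using that x ind_space_mult[OF f, of h "inv h \<otimes> x"]
      by (simp add: H_def delta_def m_assoc[symmetric])
    moreover have "delta (f h) (inv h \<otimes> x) = 0" if "h \<in> carrier G - H" for h
      using that by (auto simp: H_def delta_def)
    ultimately have "(\<Sum>h\<in>carrier G. delta (f h) (inv h \<otimes> x)) = (\<Sum>h\<in>H. f x)"
      using finite_carrier by (intro sum.mono_neutral_cong_right) (auto simp: H_def)
    also have "\<dots> = scale (of_nat (card K)) (f x)"
      using inner.scale_sum_left[of "\<lambda>_. 1" H "f x"] \<open>card H = card K\<close> by simp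
    finally show ?thesis
      using x by (simp add: fun_scale_def sum_fun_apply ind_rep_def)
  qed
qed

section \<open>Commutant elements as convolution operators\<close>

definition kernel :: "(('a \<Rightarrow> 'v) \<Rightarrow> 'a \<Rightarrow> 'v) \<Rightarrow> 'a \<Rightarrow> 'v \<Rightarrow> 'v" where
  "kernel A g v = A (delta v) g"

lemma commutantD:
  assumes "A \<in> commutant"
  shows "f \<in> I \<Longrightarrow> A f \<in> I"
    and "f \<in> I \<Longrightarrow> f' \<in> I \<Longrightarrow> A (f + f') = A f + A f'"
    and "f \<in> I \<Longrightarrow> A (fun_scale scale c f) = fun_scale scale c (A f)"
    and "f \<in> I \<Longrightarrow> g \<in> carrier G \<Longrightarrow> A (ind_rep G g f) = ind_rep G g (A f)"
  using assms unfolding intertwiners_def by blast+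

text \<open>Additivity of \<open>A\<close> is available on \<open>I\<close> only, so every partial
  sum has to be kept in \<open>I\<close>.\<close>

lemma commutant_sum:
  assumes A: "A \<in> commutant" and "finite J" "\<And>j. j \<in> J \<Longrightarrow> f j \<in> I"
  shows "A (\<Sum>j\<in>J. f j) = (\<Sum>j\<in>J. A (f j))"
  using assms(2,3)
proof (induction J rule: finite_induct)
  case empty
  show ?case
    using commutantD(3)[OF A ind.V_closed(1), of 0] by (metis ind.scale_zero_left sum.empty)
next
  case (insert j J)
  then have "f j \<in> I" "(\<Sum>j\<in>J. f j) \<in> I"
    by (auto intro: ind.subspace_sum[OF subspace_ind_space])
  then have "A (f j + (\<Sum>j\<in>J. f j)) = A (f j) + A (\<Sum>j\<in>J. f j)"
    by (rule commutantD(2)[OF A])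
  then show ?case
    using insert by (metis insertI2 sum.insert)
qed

text \<open>\<open>compose I\<close> replaces plain composition to keep the product extensional on
  \<open>I\<close>.\<close>

lemma commutant_compose:
  assumes A: "A \<in> commutant" and B: "B \<in> commutant"
  shows "compose I A B \<in> commutant"
  unfolding intertwiners_def
  using commutantD[OF A] commutantD[OF B]
  by (auto simp: compose_def ind.V_closed ind.rep_closed)

text \<open>Apply \<open>A\<close> to \<open>ind_space_expansion\<close>: as \<open>A\<close>
  commutes with translations, its values on the functions \<open>delta v\<close> determine
  it.\<close>

lemma commutant_conv:
  assumes A: "A \<in> commutant" and f: "f \<in> I" and g: "g \<in> carrier G"
  shows "scale (of_nat (card K)) (A f g) = (\<Sum>h\<in>carrier G. kernel A (inv h \<otimes> g) (f h))"
proof -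
  have "fun_scale scale (of_nat (card K)) (A f) =
      A (\<Sum>h\<in>carrier G. ind_rep G h (delta (f h)))"
    using commutantD(3)[OF A f] by (simp add: ind_space_expansion[OF f, symmetric])
  also have "\<dots> = (\<Sum>h\<in>carrier G. ind_rep G h (A (delta (f h))))"
    by (simp add: commutant_sum[OF A finite_carrier] ind.rep_closed delta_in_ind_space
        commutantD(4)[OF A])
  finally show ?thesis
    using g by (simp add: fun_scale_def fun_eq_iff sum_fun_apply ind_rep_def kernel_def)
qed

text \<open>The convolution formula for \<open>A\<close>, applied to \<open>B (delta v)\<close>:
  products of operators become convolutions of kernels.\<close>

lemma kernel_compose:
  assumes A: "A \<in> commutant" and B: "B \<in> commutant" and g: "g \<in> carrier G"
  shows "fun_scale scale (of_nat (card K)) (kernel (compose I A B) g) =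
    (\<Sum>h\<in>carrier G. kernel A (inv h \<otimes> g) \<circ> kernel B h)"
  using commutant_conv[OF A commutantD(1)[OF B delta_in_ind_space] g]
  by (auto simp: fun_scale_def sum_fun_apply kernel_def compose_def delta_in_ind_space)

lemma commutant_eqI:
  assumes A: "A \<in> commutant" and B: "B \<in> commutant" and f: "f \<in> I"
    and eq: "\<And>g. g \<in> carrier G \<Longrightarrow> kernel A g = kernel B g"
  shows "A f = B f"
proof
  fix g
  show "A f g = B f g"
  proof (cases "g \<in> carrier G")
    case True
    then have "scale (of_nat (card K)) (A f g) = scale (of_nat (card K)) (B f g)"
      by (simp add: commutant_conv[OF A f] commutant_conv[OF B f] eq)
    then show ?thesis
      using card_K by simp
  next
    case False
    then show ?thesis
      using ind_space_outside[OF commutantD(1)[OF A f]] ind_space_outside[OF commutantD(1)[OF B f]]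
      by simp
  qed
qed

lemma endomorphisms_iff:
  "T \<in> endomorphisms scale \<longleftrightarrow>
    (\<forall>v w. T (v + w) = T v + T w) \<and> (\<forall>c v. T (scale c v) = scale c (T v))"
  unfolding endomorphisms_def Vector_Spaces.linear_iff
  using inner.vector_space_axioms by simp

lemma kernel_endomorphism: "A \<in> commutant \<Longrightarrow> kernel A g \<in> endomorphisms scale"
  unfolding endomorphisms_iff kernel_def
  by (simp add: delta_add delta_scale commutantD delta_in_ind_space) (simp add: fun_scale_def)

lemma \<theta>_endomorphism: "k \<in> K \<Longrightarrow> \<theta> k \<in> endomorphisms scale"
  by (simp add: endomorphisms_iff \<theta>_add \<theta>_scale)

lemma kernel_mult_right:
  assumes "A \<in> commutant" "g \<in> carrier G" "k \<in> K"
  shows "kernel A (g \<otimes> k) = \<theta> (inv k) \<circ> kernel A g"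
  using assms commutantD(1) delta_in_ind_space ind_space_mult by (auto simp: kernel_def)

text \<open>Left multiplication by \<open>k\<close> is translation by \<open>inv k\<close>, which
  passes through \<open>A\<close> and acts on \<open>delta v\<close> through
  \<open>\<theta>\<close>.\<close>

lemma kernel_mult_left:
  assumes "A \<in> commutant" "g \<in> carrier G" "k \<in> K"
  shows "kernel A (k \<otimes> g) = kernel A g \<circ> \<theta> (inv k)"
proof
  fix v
  have "kernel A (k \<otimes> g) v = ind_rep G (inv k) (A (delta v)) g"
    using assms by (simp add: kernel_def ind_rep_def)
  also have "\<dots> = A (delta (\<theta> (inv k) v)) g"
    using assms commutantD(4)[OF assms(1) delta_in_ind_space, of "inv k" v]
    by (simp add: ind_rep_delta)
  finally show "kernel A (k \<otimes> g) v = (kernel A g \<circ> \<theta> (inv k)) v"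
    by (simp add: kernel_def)
qed

lemma conj_subgroupD:
  assumes "x \<in> conj_subgroup G K s" "s \<in> carrier G"
  shows "x \<in> K" "inv s \<otimes> x \<otimes> s \<in> K"
proof -
  obtain k where "x \<in> K" "k \<in> K" "x = s \<otimes> k \<otimes> inv s"
    using assms by (auto simp: conj_subgroup_def l_coset_def r_coset_def)
  moreover from this have "inv s \<otimes> x \<otimes> s = k"
    using assms by (simp add: m_assoc) (simp add: m_assoc[symmetric])
  ultimately show "x \<in> K" "inv s \<otimes> x \<otimes> s \<in> K"
    by simp_all
qed

text \<open>For \<open>x\<close> in \<open>conj_subgroup G K s\<close> put
  \<open>y = inv s \<otimes> x \<otimes> s\<close>. The element
  \<open>inv x \<otimes> s = s \<otimes> inv y\<close> can be evaluated by left or by right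
  covariance; comparing the two gives the intertwining relation.\<close>

lemma kernel_mackey_hom:
  assumes A: "A \<in> commutant" and s: "s \<in> carrier G"
  shows "kernel A s \<in> mackey_hom G K scale \<theta> s"
proof -
  have "kernel A s (\<theta> x v) = conj_rep G \<theta> s x (kernel A s v)"
    if x: "x \<in> conj_subgroup G K s" for x v
  proof -
    note xK = conj_subgroupD[OF x s]
    define y where "y = inv s \<otimes> x \<otimes> s"
    have y: "y \<in> K" "inv x \<otimes> s = s \<otimes> inv y"
      using xK s by (simp_all add: y_def inv_mult_group m_assoc[symmetric])
    have "kernel A (inv x \<otimes> s) v = kernel A s (\<theta> x v)"
      using kernel_mult_left[OF A s, of "inv x"] xK by simp
    moreover have "kernel A (s \<otimes> inv y) v = \<theta> y (kernel A s v)"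
      using kernel_mult_right[OF A s, of "inv y"] y by simp
    ultimately show ?thesis
      using y by (simp add: conj_rep_def y_def)
  qed
  then show ?thesis
    using kernel_endomorphism[OF A, of s]
    by (simp add: mackey_hom_def intertwiners_def endomorphisms_iff)
qed

text \<open>Unitarity gives the adjoint relation, and definiteness of \<open>ip\<close> the
  uniqueness required by \<open>THE\<close>. The adjoints in the hypothesis on \<open>\<S>\<close>
  thereby become the factors in \<open>kernel_double_coset\<close>.\<close>

lemma \<theta>_adjoint:
  assumes "k \<in> K"
  shows "ip_adjoint ip (\<theta> k) = \<theta> (inv k)"
proof -
  have adj: "ip (\<theta> k v) w = ip v (\<theta> (inv k) w)" for v w
    using assms inner.rep_unitary[of k v "\<theta> (inv k) w"] \<theta>_mult[of k "inv k" w] by simp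
  show ?thesis
    unfolding ip_adjoint_def
  proof (rule the_equality)
    fix T assume T: "\<forall>v w. ip (\<theta> k v) w = ip v (T w)"
    have "ip v (T w - \<theta> (inv k) w) = 0" for v w
      using T adj by (simp add: inner.ip_diff_right)
    then show "T = \<theta> (inv k)"
      using inner.ip_self_eq_0_iff by (metis UNIV_I eq_iff_diff_eq_0 ext)
  qed (use adj in simp)
qed

lemma endomorphisms_closed:
  "0 \<in> endomorphisms scale"
  "S \<in> endomorphisms scale \<Longrightarrow> T \<in> endomorphisms scale \<Longrightarrow> S + T \<in> endomorphisms scale"
  "S \<in> endomorphisms scale \<Longrightarrow> T \<in> endomorphisms scale \<Longrightarrow> S \<circ> T \<in> endomorphisms scale"
  "T \<in> endomorphisms scale \<Longrightarrow> fun_scale scale c T \<in> endomorphisms scale"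
  by (auto simp: endomorphisms_iff fun_scale_def inner.scale_right_distrib inner.scale_left_commute)

section \<open>Symmetry of the kernels under the two antiautomorphisms\<close>

context
  fixes sharp :: "('v \<Rightarrow> 'v) \<Rightarrow> 'v \<Rightarrow> 'v" and \<tau> :: "'a \<Rightarrow> 'a"
  assumes sharp: "algebra_antiautomorphism scale sharp"
    and \<tau>: "group_antiautomorphism G \<tau>"
begin

lemma sharp_inj: "inj_on sharp (endomorphisms scale)"
  using sharp by (auto simp: algebra_antiautomorphism_def bij_betw_def)

lemma sharp_add:
  "S \<in> endomorphisms scale \<Longrightarrow> T \<in> endomorphisms scale \<Longrightarrow> sharp (S + T) = sharp S + sharp T"
  using sharp unfolding algebra_antiautomorphism_def by blast

lemma sharp_scale:
  "T \<in> endomorphisms scale \<Longrightarrow> sharp (fun_scale scale c T) = fun_scale scale c (sharp T)"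
  using sharp unfolding algebra_antiautomorphism_def by blast

lemma sharp_comp:
  "S \<in> endomorphisms scale \<Longrightarrow> T \<in> endomorphisms scale \<Longrightarrow> sharp (S \<circ> T) = sharp T \<circ> sharp S"
  using sharp unfolding algebra_antiautomorphism_def by blast

lemma sharp_zero: "sharp 0 = 0"
  using sharp_add[OF endomorphisms_closed(1) endomorphisms_closed(1)]
  by (metis add_cancel_left_left add_0)

text \<open>Membership in \<open>endomorphisms scale\<close> is carried through the induction
  because \<open>sharp_add\<close> needs it for the partial sums.\<close>

lemma sharp_sum:
  assumes "finite J" "\<And>j. j \<in> J \<Longrightarrow> T j \<in> endomorphisms scale"
  shows "sharp (\<Sum>j\<in>J. T j) = (\<Sum>j\<in>J. sharp (T j)) \<and> (\<Sum>j\<in>J. T j) \<in> endomorphisms scale"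
  using assms
proof (induction J rule: finite_induct)
  case empty
  show ?case using sharp_zero endomorphisms_closed(1) by (metis sum.empty)
next
  case (insert j J)
  then have "sharp (T j + (\<Sum>j\<in>J. T j)) = sharp (T j) + (\<Sum>j\<in>J. sharp (T j))"
    "T j + (\<Sum>j\<in>J. T j) \<in> endomorphisms scale"
    using sharp_add[of "T j" "\<Sum>j\<in>J. T j"] endomorphisms_closed(2)[of "T j" "\<Sum>j\<in>J. T j"]
    by simp_all
  then show ?case
    using insert by (metis sum.insert)
qed

lemma \<tau>_bij: "bij_betw \<tau> (carrier G) (carrier G)"
  using \<tau> by (simp add: group_antiautomorphism_def)

lemma \<tau>_closed [simp]: "g \<in> carrier G \<Longrightarrow> \<tau> g \<in> carrier G"
  using \<tau>_bij bij_betwE by blast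

lemma \<tau>_mult: "g \<in> carrier G \<Longrightarrow> h \<in> carrier G \<Longrightarrow> \<tau> (g \<otimes> h) = \<tau> h \<otimes> \<tau> g"
  using \<tau> by (simp add: group_antiautomorphism_def)

lemma \<tau>_inv: "g \<in> carrier G \<Longrightarrow> \<tau> (inv g) = inv (\<tau> g)"
proof -
  assume g: "g \<in> carrier G"
  \<comment> \<open>An idempotent of a group is the identity.\<close>
  have "\<tau> \<one> \<otimes> \<tau> \<one> = \<tau> \<one>"
    using \<tau>_mult[of \<one> \<one>] by simp
  then have "\<tau> \<one> = \<one>"
    using r_cancel_one by simp
  then show ?thesis
    using g \<tau>_mult[of g "inv g"] inv_equality[of "\<tau> (inv g)" "\<tau> g"] by simp
qed

text \<open>It suffices to compare the kernels of the two products. The chain computes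
  \<open>sharp\<close> of the kernel of \<open>AB\<close> until it becomes \<open>sharp\<close> of
  the kernel of \<open>BA\<close>, and injectivity of \<open>sharp\<close> finishes.\<close>

lemma commutant_commutative:
  assumes sym: "\<And>A g. A \<in> commutant \<Longrightarrow> g \<in> carrier G \<Longrightarrow> kernel A (\<tau> g) = sharp (kernel A g)"
    and A: "A \<in> commutant" and B: "B \<in> commutant" and f: "f \<in> I"
  shows "A (B f) = B (A f)"
proof -
  note AB = commutant_compose[OF A B] and BA = commutant_compose[OF B A]
  define n where "n = (of_nat (card K) :: complex)"
  note comp = kernel_compose[folded n_def]
  have "kernel (compose I A B) g = kernel (compose I B A) g" if g: "g \<in> carrier G" for g
  proof -
    have "sharp (fun_scale scale n (kernel (compose I A B) g))
        = fun_scale scale n (kernel (compose I A B) (\<tau> g))"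
      using sym[OF AB g] sharp_scale[OF kernel_endomorphism[OF AB]] by simp
    also have "\<dots> = (\<Sum>h\<in>carrier G. kernel A (inv h \<otimes> \<tau> g) \<circ> kernel B h)"
      using comp[OF A B] g by simp
    \<comment> \<open>Reindexing by the bijection \<open>\<tau>\<close> turns every argument into a
      value of \<open>\<tau>\<close>, so that \<open>sym\<close> applies to both factors.\<close>
    also have "\<dots> = (\<Sum>h\<in>carrier G. kernel A (inv (\<tau> h) \<otimes> \<tau> g) \<circ> kernel B (\<tau> h))"
      using sum.reindex_bij_betw[OF \<tau>_bij,
          of "\<lambda>h. kernel A (inv h \<otimes> \<tau> g) \<circ> kernel B h"] by simp
    also have "\<dots> = (\<Sum>h\<in>carrier G. sharp (kernel B h \<circ> kernel A (g \<otimes> inv h)))"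
    proof (rule sum.cong[OF refl])
      fix h assume h: "h \<in> carrier G"
      have "inv (\<tau> h) \<otimes> \<tau> g = \<tau> (g \<otimes> inv h)"
        using g h by (simp add: \<tau>_mult \<tau>_inv)
      then show "kernel A (inv (\<tau> h) \<otimes> \<tau> g) \<circ> kernel B (\<tau> h)
          = sharp (kernel B h \<circ> kernel A (g \<otimes> inv h))"
        using sym[OF A, of "g \<otimes> inv h"] sym[OF B h] g h
          sharp_comp[OF kernel_endomorphism[OF B] kernel_endomorphism[OF A]] by simp
    qed
    also have "\<dots> = sharp (\<Sum>h\<in>carrier G. kernel B h \<circ> kernel A (g \<otimes> inv h))"
      using sharp_sum[OF finite_carrier, of "\<lambda>h. kernel B h \<circ> kernel A (g \<otimes> inv h)"]
        endomorphisms_closed(3)[OF kernel_endomorphism[OF B] kernel_endomorphism[OF A]] by simp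
    \<comment> \<open>The substitution \<open>t = g \<otimes> inv h\<close> brings the sum into the
      form of \<open>kernel_compose\<close> for \<open>B\<close> and \<open>A\<close>.\<close>
    also have "(\<Sum>h\<in>carrier G. kernel B h \<circ> kernel A (g \<otimes> inv h))
        = (\<Sum>t\<in>carrier G. kernel B (inv t \<otimes> g) \<circ> kernel A t)"
      by (rule sum.reindex_bij_witness[where i = "\<lambda>t. inv t \<otimes> g" and j = "\<lambda>h. g \<otimes> inv h"])
        (use g in \<open>simp_all add: inv_mult_group m_assoc\<close>,
         use g in \<open>simp_all add: m_assoc[symmetric]\<close>)
    also have "\<dots> = fun_scale scale n (kernel (compose I B A) g)"
      using comp[OF B A g] by simp
    finally have "fun_scale scale n (kernel (compose I A B) g)
        = fun_scale scale n (kernel (compose I B A) g)"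
      using sharp_inj endomorphisms_closed(4) kernel_endomorphism[OF AB] kernel_endomorphism[OF BA]
      by (auto dest: inj_onD)
    then show ?thesis
      using card_K by (auto simp: fun_scale_def n_def fun_eq_iff)
  qed
  then have "compose I A B f = compose I B A f"
    using commutant_eqI[OF AB BA f] by blast
  then show ?thesis
    using f by (simp add: compose_def)
qed

lemma kernel_double_coset:
  assumes "A \<in> commutant" "g \<in> carrier G" "k \<in> K" "l \<in> K"
  shows "kernel A (k \<otimes> g \<otimes> l) = \<theta> (inv l) \<circ> kernel A g \<circ> \<theta> (inv k)"
  using assms by (simp add: kernel_mult_left kernel_mult_right comp_assoc)

lemma in_double_coset_iff:
  assumes "s \<in> carrier G"
  shows "g \<in> double_coset G K s \<longleftrightarrow> (\<exists>k\<in>K. \<exists>l\<in>K. g = k \<otimes> s \<otimes> l)"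
  using assms by (auto simp: double_coset_def set_mult_def l_coset_def m_assoc)

text \<open>Two-sided covariance reduces the claim to representatives. On the support it is the
  hypothesis with the kernel as \<open>T\<close>; off the support both sides vanish.\<close>

lemma kernel_antiautomorphism:
  assumes reps: "double_coset_reps G K \<S>"
    and \<tau>_K: "\<tau> ` K = K"
    and \<theta>_\<tau>: "\<And>k. k \<in> K \<Longrightarrow> \<theta> (\<tau> k) = sharp (\<theta> k)"
    and support: "\<And>s. s \<in> mackey_support G K scale \<theta> \<S> \<Longrightarrow> \<exists>k\<^sub>1\<in>K. \<exists>k\<^sub>2\<in>K.
        \<tau> s = k\<^sub>1 \<otimes> s \<otimes> k\<^sub>2 \<and>
        (\<forall>T\<in>mackey_hom G K scale \<theta> s.
          ip_adjoint ip (\<theta> k\<^sub>2) \<circ> T \<circ> ip_adjoint ip (\<theta> k\<^sub>1) = sharp T)"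
    and A: "A \<in> commutant" and g: "g \<in> carrier G"
  shows "kernel A (\<tau> g) = sharp (kernel A g)"
proof -
  have S: "s \<in> carrier G" if "s \<in> \<S>" for s
    using reps that by (auto simp: double_coset_reps_def)
  have rep: "\<exists>s\<in>\<S>. \<exists>k\<in>K. \<exists>l\<in>K. x = k \<otimes> s \<otimes> l" if "x \<in> carrier G" for x
    using reps that S in_double_coset_iff unfolding double_coset_reps_def by metis
  have rep_unique: "s = s'"
    if "s \<in> \<S>" "s' \<in> \<S>" "k \<in> K" "l \<in> K" "s = k \<otimes> s' \<otimes> l" for s s' k l
  proof -
    have "s \<in> double_coset G K s" "s \<in> double_coset G K s'"
      using that S in_double_coset_iff by (metis K_closed(4) l_one r_one, metis)
    then show ?thesis
      using reps that S unfolding double_coset_reps_def by blast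
  qed
  \<comment> \<open>The kernel at \<open>s\<close> lies in \<open>mackey_hom\<close>, which is zero
    off the support.\<close>
  have vanish: "kernel A s = 0" if "s \<in> \<S>" "s \<notin> mackey_support G K scale \<theta> \<S>" for s
    using kernel_mackey_hom[OF A S[OF that(1)]] that by (auto simp: mackey_support_def)
  have \<tau>K: "\<tau> k \<in> K" if "k \<in> K" for k
    using \<tau>_K that by blast
  have \<tau>_S: "kernel A (\<tau> s) = sharp (kernel A s)" if s: "s \<in> \<S>" for s
  proof (cases "s \<in> mackey_support G K scale \<theta> \<S>")
    case True
    then obtain k\<^sub>1 k\<^sub>2 where k: "k\<^sub>1 \<in> K" "k\<^sub>2 \<in> K" "\<tau> s = k\<^sub>1 \<otimes> s \<otimes> k\<^sub>2"
      "\<And>T. T \<in> mackey_hom G K scale \<theta> s \<Longrightarrow>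
        ip_adjoint ip (\<theta> k\<^sub>2) \<circ> T \<circ> ip_adjoint ip (\<theta> k\<^sub>1) = sharp T"
      using support by blast
    then show ?thesis
      using k(4)[OF kernel_mackey_hom[OF A S[OF s]]]
      by (simp add: kernel_double_coset[OF A S[OF s]] \<theta>_adjoint)
  next
    case False
    obtain s' k l where s': "s' \<in> \<S>" "k \<in> K" "l \<in> K" "\<tau> s = k \<otimes> s' \<otimes> l"
      using rep[of "\<tau> s"] S s by auto
    \<comment> \<open>If \<open>s'\<close> were in the support, \<open>\<tau>\<close> would map its
      double coset to itself; then \<open>s\<close>, whose image lies there, would represent the
      same double coset, so \<open>s = s'\<close>, against the case assumption.\<close>
    have "s' \<notin> mackey_support G K scale \<theta> \<S>"
    proof
      assume supp: "s' \<in> mackey_support G K scale \<theta> \<S>"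
      then obtain k\<^sub>1 k\<^sub>2 where k: "k\<^sub>1 \<in> K" "k\<^sub>2 \<in> K" "\<tau> s' = k\<^sub>1 \<otimes> s' \<otimes> k\<^sub>2"
        using support by blast
      \<comment> \<open>Chosen through surjectivity of \<open>\<tau>\<close> on \<open>K\<close> so
        that the order reversal in \<open>\<tau> (b \<otimes> s' \<otimes> a)\<close> cancels
        \<open>k\<^sub>1\<close> and \<open>k\<^sub>2\<close> and leaves
        \<open>k \<otimes> s' \<otimes> l = \<tau> s\<close>.\<close>
      obtain a b where ab: "a \<in> K" "b \<in> K" "\<tau> a = k \<otimes> inv k\<^sub>1" "\<tau> b = inv k\<^sub>2 \<otimes> l"
        using \<tau>_K k s' K_closed(2,3) by (metis imageE)
      have car: "s \<in> carrier G" "s' \<in> carrier G" "a \<in> carrier G" "b \<in> carrier G"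
        "k \<in> carrier G" "l \<in> carrier G" "k\<^sub>1 \<in> carrier G" "k\<^sub>2 \<in> carrier G"
        using s s' ab k S by auto
      have cancel: "inv x \<otimes> (x \<otimes> y) = y" "x \<otimes> (inv x \<otimes> y) = y"
        if "x \<in> carrier G" "y \<in> carrier G" for x y
        using that by (simp_all add: m_assoc[symmetric])
      have "\<tau> (b \<otimes> s' \<otimes> a) = k \<otimes> inv k\<^sub>1 \<otimes> (k\<^sub>1 \<otimes> s' \<otimes> k\<^sub>2) \<otimes> (inv k\<^sub>2 \<otimes> l)"
        using car by (simp add: \<tau>_mult ab k m_assoc)
      also have "\<dots> = \<tau> s"
        using car s'(4) by (simp add: m_assoc cancel)
      finally have "s = b \<otimes> s' \<otimes> a"
        using \<tau>_bij car by (auto simp: bij_betw_def dest: inj_onD)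
      then have "s = s'"
        using rep_unique[of s s' b a] s s' ab by blast
      then show False
        using supp False by simp
    qed
    then have "kernel A (\<tau> s) = \<theta> (inv l) \<circ> 0 \<circ> \<theta> (inv k)"
      using s' S vanish by (simp add: kernel_double_coset[OF A])
    also have "\<dots> = 0"
      using s' by (auto simp: \<theta>_zero)
    finally show ?thesis
      using vanish[OF s False] sharp_zero by simp
  qed
  obtain s k l where s: "s \<in> \<S>" "k \<in> K" "l \<in> K" "g = k \<otimes> s \<otimes> l"
    using rep[OF g] by blast
  have \<theta>: "\<theta> (inv (\<tau> k)) = sharp (\<theta> (inv k))" if "k \<in> K" for k
    using that \<theta>_\<tau>[of "inv k"] \<tau>_inv[of k] by simp
  \<comment> \<open>Here \<open>\<tau>\<close> reverses the three factors of \<open>g\<close>,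
    covariance reverses the outer two again, and \<open>sharp\<close> then reassembles the product
    in its original order.\<close>
  have "\<tau> g = \<tau> l \<otimes> \<tau> s \<otimes> \<tau> k"
    using s S by (simp add: \<tau>_mult m_assoc)
  then have "kernel A (\<tau> g) = sharp (\<theta> (inv k)) \<circ> sharp (kernel A s) \<circ> sharp (\<theta> (inv l))"
    using s S \<tau>K \<tau>_S by (simp add: kernel_double_coset[OF A] \<theta>)
  also have "\<dots> = sharp (\<theta> (inv l) \<circ> kernel A s \<circ> \<theta> (inv k))"
    using s by (simp add: sharp_comp endomorphisms_closed(3) \<theta>_endomorphism
        kernel_endomorphism[OF A] comp_assoc)
  finally show ?thesis
    using s S by (simp add: kernel_double_coset[OF A])
qed

end

end

theorem theorem4p5:
  fixes G :: "('g, 'm) monoid_scheme" (structure)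
    and K :: "'g set"
    and scale :: "complex \<Rightarrow> 'v::ab_group_add \<Rightarrow> 'v"
    and ip :: "'v \<Rightarrow> 'v \<Rightarrow> complex"
    and \<theta> :: "'g \<Rightarrow> 'v \<Rightarrow> 'v"
    and sharp :: "('v \<Rightarrow> 'v) \<Rightarrow> 'v \<Rightarrow> 'v"
    and \<S> :: "'g set"
  assumes "group G" and "finite (carrier G)" and "subgroup K G"
    and "irreducible_rep (G\<lparr>carrier := K\<rparr>) scale UNIV ip \<theta>"
    and "algebra_antiautomorphism scale sharp"
    and "double_coset_reps G K \<S>" and "\<one> \<in> \<S>"
    and "\<exists>\<tau>. group_antiautomorphism G \<tau> \<and>
      \<tau> ` K = K \<and>
      (\<forall>k\<in>K. \<theta> (\<tau> k) = sharp (\<theta> k)) \<and>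
      (\<forall>s\<in>mackey_support G K scale \<theta> \<S>. \<exists>k\<^sub>1\<in>K. \<exists>k\<^sub>2\<in>K.
        \<tau> s = k\<^sub>1 \<otimes> s \<otimes> k\<^sub>2 \<and>
        (\<forall>T\<in>mackey_hom G K scale \<theta> s.
          ip_adjoint ip (\<theta> k\<^sub>2) \<circ> T \<circ> ip_adjoint ip (\<theta> k\<^sub>1) = sharp T)) \<and>
      (\<forall>T\<in>endomorphisms scale. ip_adjoint ip (sharp T) = sharp (ip_adjoint ip T))"
  shows "multiplicity_free_triple G K scale ip \<theta>"
proof -
  interpret inner: irreducible_rep "G\<lparr>carrier := K\<rparr>" scale UNIV ip \<theta>
    by fact
  interpret induced G K scale ip \<theta>
    by (intro induced.intro induced_axioms.intro assms inner.unitary_rep_axioms)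
  obtain \<tau> where \<tau>: "group_antiautomorphism G \<tau>" "\<tau> ` K = K"
    "\<forall>k\<in>K. \<theta> (\<tau> k) = sharp (\<theta> k)"
    "\<forall>s\<in>mackey_support G K scale \<theta> \<S>. \<exists>k\<^sub>1\<in>K. \<exists>k\<^sub>2\<in>K.
      \<tau> s = k\<^sub>1 \<otimes> s \<otimes> k\<^sub>2 \<and>
      (\<forall>T\<in>mackey_hom G K scale \<theta> s.
        ip_adjoint ip (\<theta> k\<^sub>2) \<circ> T \<circ> ip_adjoint ip (\<theta> k\<^sub>1) = sharp T)"
    using assms(8) by blast
  have sym: "kernel A (\<tau> g) = sharp (kernel A g)" if "A \<in> commutant" "g \<in> carrier G" for A g
    using kernel_antiautomorphism[OF assms(5) \<tau>(1) assms(6) \<tau>(2)] \<tau>(3,4) that by blast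
  show ?thesis
    \<comment> \<open>Symmetric kernels make the commutant commutative, and a commutative commutant
      rules out repeated constituents.\<close>
    unfolding multiplicity_free_triple_def
    using commutant_commutative[OF assms(5) \<tau>(1) sym]
    by (intro ind.multiplicity_free_if_commutative) blast
qed

end
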